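(* Let $(X,\mathcal{F},\mu)$ be a measure space, and let $f : X \to [0,\infty]$ be a measurable function with $\int_X f\,\mathrm{d}\mu = \infty$. Let $(f_n)_{n\in\mathbb{N}}$ be a sequence of measurable functions from $X$ to $[0,\infty]$ which converge to $f$ pointwise on $X$. Then $$\lim_{n\to\infty} \int_X f_n\,\mathrm{d}\mu = \infty.$$
   Context: Integrals of measurable functions with values in $[0,\infty]$ take values in $[0,\infty]$, and limits are taken in $[0,\infty]$ (the value $\infty$ is allowed). *)

theory Defs
  imports "HOL-Analysis.Analysis"
begin

end

theory Submission
  imports Defs
begin

text \<open>
  Mass can escape in a pointwise limit but cannot be created: by Fatou's lemma, the integral of
  \<open>f = liminf F\<^sub>n\<close> is at most the limit inferior of the integrals of the \<open>F\<^sub>n\<close>. Here the former is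
  already the top element of \<open>[0,\<infinity>]\<close>, so the limit inferior of the integrals is \<open>\<infinity>\<close>. The limit
  superior lies above it and is \<open>\<infinity>\<close> as well, hence the limit exists and equals \<open>\<infinity>\<close>.
\<close>

theorem theorem1p3:
  fixes M :: "'a measure"
    and f :: "'a \<Rightarrow> ennreal"
    and F :: "nat \<Rightarrow> 'a \<Rightarrow> ennreal"
  assumes "f \<in> borel_measurable M"
    and "(\<integral>\<^sup>+ x. f x \<partial>M) = \<infinity>"
    and "\<And>n. F n \<in> borel_measurable M"
    and "\<And>x. x \<in> space M \<Longrightarrow> (\<lambda>n. F n x) \<longlonglongrightarrow> f x"
  shows "(\<lambda>n. \<integral>\<^sup>+ x. F n x \<partial>M) \<longlonglongrightarrow> \<infinity>"
proof -
  have "\<infinity> = (\<integral>\<^sup>+ x. liminf (\<lambda>n. F n x) \<partial>M)"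
    unfolding assms(2)[symmetric]
    by (intro nn_integral_cong lim_imp_Liminf[symmetric] assms(4)) simp_all
  also have "\<dots> \<le> liminf (\<lambda>n. \<integral>\<^sup>+ x. F n x \<partial>M)"
    by (rule nn_integral_liminf) (rule assms(3))
  finally have Liminf: "liminf (\<lambda>n. \<integral>\<^sup>+ x. F n x \<partial>M) = \<infinity>"
    by (simp add: top_unique)
  moreover have "limsup (\<lambda>n. \<integral>\<^sup>+ x. F n x \<partial>M) = \<infinity>"
    using Liminf_le_Limsup[of sequentially "\<lambda>n. \<integral>\<^sup>+ x. F n x \<partial>M"] Liminf
    by (simp add: top_unique)
  ultimately show ?thesis
    by (intro Liminf_eq_Limsup) simp_all
qed

end
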